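(* Let $M$ be a $C$-totally real submanifold of an $(LCS)_n$-manifold $\widetilde{M}$. Then the scalar curvature $\tau$ of $M$ with respect to the induced Levi-Civita connection and the scalar curvature $\overline{\tau}$ of $M$ with respect to the induced quarter symmetric metric connection are the same, i.e. $\tau=\overline{\tau}$.
   Context: $(LCS)_n$-manifold: an $n$-dimensional Lorentzian manifold $(\widetilde{M},g)$ with Levi-Civita connection $\widetilde{\nabla}$, admitting a unit timelike concircular vector field $\xi$ (the characteristic vector field), i.e. $g(\xi,\xi)=-1$ and, with the 1-form $\eta(X)=g(X,\xi)$, one has $(\widetilde{\nabla}_X\eta)(Y)=\alpha\{g(X,Y)+\eta(X)\eta(Y)\}$ (equivalently $\widetilde{\nabla}_X\xi=\alpha\{X+\eta(X)\xi\}$), where $\alpha$ is a non-zero scalar function satisfying $\widetilde{\nabla}_X\alpha=X\alpha=d\alpha(X)=\rho\,\eta(X)$ with $\rho=-(\xi\alpha)$. The structure tensor is the $(1,1)$-tensor $\phi X=\frac{1}{\alpha}\widetilde{\nabla}_X\xi=X+\eta(X)\xi$. Quarter symmetric metric connection on $\widetilde{M}$: $\overline{\widetilde{\nabla}}_XY=\widetilde{\nabla}_XY+\eta(Y)\phi X-g(\phi X,Y)\xi$. Submanifolds: $M$ is a submanifold of dimension $m<n$ with induced metric $g$, induced Levi-Civita connection $\nabla$, normal bundle $T^\perp M$, and second fundamental form $h$ given by $\widetilde{\nabla}_XY=\nabla_XY+h(X,Y)$ for $X,Y$ tangent to $M$. $M$ is $C$-totally real if $\xi$ is normal to $M$, i.e.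 $\eta(X)=0$ for all $X$ tangent to $M$. The connection $\overline{\nabla}$ induced on $M$ by $\overline{\widetilde{\nabla}}$ and the corresponding second fundamental form $\overline{h}$ are the tangential and normal parts in $\overline{\widetilde{\nabla}}_XY=\overline{\nabla}_XY+\overline{h}(X,Y)$. Notation: for an orthonormal basis $\{e_1,\dots,e_m\}$ of $T_xM$, with $R$, $\overline{R}$ the curvature tensors of $\nabla$, $\overline{\nabla}$ and $R(X,Y,Z,W)=g(R(X,Y)Z,W)$, $\overline{R}(X,Y,Z,W)=g(\overline{R}(X,Y)Z,W)$, the scalar curvatures are $\tau=\sum_{1\le i<j\le m}R(e_i,e_j,e_j,e_i)$ and $\overline{\tau}=\sum_{1\le i<j\le m}\overline{R}(e_i,e_j,e_j,e_i)$. *)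

theory Defs
  imports "HOL-Analysis.Analysis" "HOL-Library.Function_Algebras"
begin

section \<open>Smooth manifolds\<close>

text \<open>\<open>C\<^sup>k\<close> maps between normed spaces. The definition is only meant for open sets \<open>S\<close>.\<close>

primrec Ck_on :: "nat \<Rightarrow> 'v::real_normed_vector set \<Rightarrow> ('v \<Rightarrow> 'w::real_normed_vector) \<Rightarrow> bool" where
  "Ck_on 0 S f \<longleftrightarrow> continuous_on S f"
| "Ck_on (Suc k) S f \<longleftrightarrow>
     (\<forall>x\<in>S. f differentiable (at x)) \<and> (\<forall>v. Ck_on k S (\<lambda>x. frechet_derivative f (at x) v))"

definition smooth_on :: "'v::real_normed_vector set \<Rightarrow> ('v \<Rightarrow> 'w::real_normed_vector) \<Rightarrow> bool" where
  "smooth_on S f \<longleftrightarrow> (\<forall>k. Ck_on k S f)"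

text \<open>
  The underlying space of a manifold is a whole type (Hausdorff and second countable by its type
  class); the dimension is the cardinality of the index type \<open>'n\<close>. A chart is a pair
  \<open>(U, \<phi>)\<close>; the values of \<open>\<phi>\<close> outside \<open>U\<close> are irrelevant, and the inverse chart is
  \<open>inv_into U \<phi>\<close>. The atlas is not required to be maximal.
\<close>

type_synonym ('a, 'n) chart = "'a set \<times> ('a \<Rightarrow> real ^ 'n)"

definition smooth_manifold ::
  "('a::{t2_space, second_countable_topology}, 'n::finite) chart set \<Rightarrow> bool" where
  "smooth_manifold A \<longleftrightarrow>
     (\<Union>(U, \<phi>)\<in>A. U) = UNIV \<and>
     (\<forall>(U, \<phi>)\<in>A. open U \<and> open (\<phi> ` U) \<and> homeomorphism U (\<phi> ` U) \<phi> (inv_into U \<phi>)) \<and>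
     (\<forall>(U, \<phi>)\<in>A. \<forall>(V, \<psi>)\<in>A. smooth_on (\<phi> ` (U \<inter> V)) (\<psi> \<circ> inv_into U \<phi>))"

definition smooth_fun ::
  "('a::topological_space, 'n::finite) chart set \<Rightarrow> 'a set \<Rightarrow> ('a \<Rightarrow> real) \<Rightarrow> bool" where
  "smooth_fun A U f \<longleftrightarrow>
     open U \<and> (\<forall>(V, \<phi>)\<in>A. smooth_on (\<phi> ` (U \<inter> V)) (f \<circ> inv_into V \<phi>))"

definition smooth_near ::
  "('a::topological_space, 'n::finite) chart set \<Rightarrow> 'a \<Rightarrow> ('a \<Rightarrow> real) \<Rightarrow> bool" where
  "smooth_near A p f \<longleftrightarrow> (\<exists>U. p \<in> U \<and> smooth_fun A U f)"

definition smooth_map ::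
  "('b::topological_space, 'm::finite) chart set \<Rightarrow> ('a::topological_space, 'n::finite) chart set
    \<Rightarrow> ('b \<Rightarrow> 'a) \<Rightarrow> bool" where
  "smooth_map A B F \<longleftrightarrow>
     continuous_on UNIV F \<and>
     (\<forall>(U, \<phi>)\<in>A. \<forall>(V, \<psi>)\<in>B. smooth_on (\<phi> ` (U \<inter> F -` V)) (\<psi> \<circ> F \<circ> inv_into U \<phi>))"


section \<open>Tangent vectors and vector fields\<close>

text \<open>
  Following Kobayashi and Nomizu, a tangent vector at \<open>p\<close> is the operator
  \<open>f \<mapsto> (d/dt) f(c(t))\<close> at \<open>t = 0\<close>, for a smooth curve \<open>c\<close> with \<open>c 0 = p\<close>, acting on the
  functions that are smooth near \<open>p\<close>. So that operators can be compared by equality of HOL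
  functions, they are set to \<open>0\<close> on functions that are not smooth near \<open>p\<close>. Addition of tangent
  vectors is pointwise.
\<close>

type_synonym 'a tvec = "('a \<Rightarrow> real) \<Rightarrow> real"

definition tscale :: "real \<Rightarrow> 'a tvec \<Rightarrow> 'a tvec" (infixr \<open>\<odot>\<close> 75) where
  "a \<odot> v = (\<lambda>f. a * v f)"

definition smooth_curve :: "('a::topological_space, 'n::finite) chart set \<Rightarrow> (real \<Rightarrow> 'a) \<Rightarrow> bool" where
  "smooth_curve A c \<longleftrightarrow>
     (\<exists>\<epsilon>>0. continuous_on {-\<epsilon><..<\<epsilon>} c \<and>
       (\<forall>(V, \<psi>)\<in>A. smooth_on ({-\<epsilon><..<\<epsilon>} \<inter> c -` V) (\<psi> \<circ> c)))"

definition velocity :: "('a::topological_space, 'n::finite) chart set \<Rightarrow> (real \<Rightarrow> 'a) \<Rightarrow> 'a tvec" where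
  "velocity A c = (\<lambda>f. if smooth_near A (c 0) f then deriv (f \<circ> c) 0 else 0)"

definition tangent_space :: "('a::topological_space, 'n::finite) chart set \<Rightarrow> 'a \<Rightarrow> 'a tvec set" where
  "tangent_space A p = {velocity A c | c. smooth_curve A c \<and> c 0 = p}"

definition pushforward ::
  "('a::topological_space, 'n::finite) chart set \<Rightarrow> ('b \<Rightarrow> 'a) \<Rightarrow> 'b \<Rightarrow> 'b tvec \<Rightarrow> 'a tvec" where
  "pushforward B F p v = (\<lambda>f. if smooth_near B (F p) f then v (f \<circ> F) else 0)"

text \<open>
  Vector fields are considered on arbitrary open sets \<open>U\<close>; as HOL functions they are total, but
  their values outside \<open>U\<close> are irrelevant.
\<close>

type_synonym 'a vfield = "'a \<Rightarrow> 'a tvec"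

definition smooth_field ::
  "('a::topological_space, 'n::finite) chart set \<Rightarrow> 'a set \<Rightarrow> 'a vfield \<Rightarrow> bool" where
  "smooth_field A U X \<longleftrightarrow>
     open U \<and> (\<forall>p\<in>U. X p \<in> tangent_space A p) \<and>
     (\<forall>W f. W \<subseteq> U \<longrightarrow> smooth_fun A W f \<longrightarrow> smooth_fun A W (\<lambda>p. X p f))"

definition lie_bracket ::
  "('a::topological_space, 'n::finite) chart set \<Rightarrow> 'a vfield \<Rightarrow> 'a vfield \<Rightarrow> 'a vfield" where
  "lie_bracket A X Y = (\<lambda>p f. if smooth_near A p f
     then X p (\<lambda>q. Y q f) - Y p (\<lambda>q. X q f) else 0)"

definition coord_field ::
  "('a::topological_space, 'n::finite) chart set \<Rightarrow> ('a, 'n) chart \<Rightarrow> 'n \<Rightarrow> 'a vfield" where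
  "coord_field A = (\<lambda>(V, \<psi>) k p f. if smooth_near A p f
     then frechet_derivative (f \<circ> inv_into V \<psi>) (at (\<psi> p)) (axis k 1) else 0)"


section \<open>Metrics and connections\<close>

type_synonym 'a metric_field = "'a \<Rightarrow> 'a tvec \<Rightarrow> 'a tvec \<Rightarrow> real"

text \<open>
  A basis \<open>e 1, \<dots>, e m\<close> of \<open>T\<close> that is orthonormal for \<open>G\<close>, with exactly the first \<open>k\<close> vectors
  timelike.
\<close>

definition orthonormal_frame ::
  "'a tvec set \<Rightarrow> ('a tvec \<Rightarrow> 'a tvec \<Rightarrow> real) \<Rightarrow> nat \<Rightarrow> nat \<Rightarrow> (nat \<Rightarrow> 'a tvec) \<Rightarrow> bool" where
  "orthonormal_frame T G k m e \<longleftrightarrow>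
     (\<forall>i\<in>{1..m}. e i \<in> T) \<and>
     (\<forall>i\<in>{1..m}. \<forall>j\<in>{1..m}. G (e i) (e j) = (if i \<noteq> j then 0 else if i \<le> k then -1 else 1)) \<and>
     (\<forall>v\<in>T. \<exists>a. v = (\<Sum>i=1..m. a i \<odot> e i))"

definition lorentzian_metric ::
  "('a::topological_space, 'n::finite) chart set \<Rightarrow> 'a metric_field \<Rightarrow> bool" where
  "lorentzian_metric A g \<longleftrightarrow>
     (\<forall>p. \<forall>u\<in>tangent_space A p. \<forall>v\<in>tangent_space A p. \<forall>w\<in>tangent_space A p. \<forall>a b.
        g p u v = g p v u \<and> g p (a \<odot> u + b \<odot> v) w = a * g p u w + b * g p v w) \<and>
     (\<forall>U X Y. smooth_field A U X \<longrightarrow> smooth_field A U Y \<longrightarrow> smooth_fun A U (\<lambda>p. g p (X p) (Y p))) \<and>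
     (\<forall>p. \<exists>e. orthonormal_frame (tangent_space A p) (g p) 1 CARD('n) e)"

text \<open>
  \<open>D X Y\<close> is the covariant derivative of \<open>Y\<close> along \<open>X\<close>. Connections act on vector fields
  defined on open sets, compatibly with restriction (the last condition).
\<close>

type_synonym 'a connection = "'a vfield \<Rightarrow> 'a vfield \<Rightarrow> 'a vfield"

definition affine_connection ::
  "('a::topological_space, 'n::finite) chart set \<Rightarrow> 'a connection \<Rightarrow> bool" where
  "affine_connection A D \<longleftrightarrow>
     (\<forall>U X Y. smooth_field A U X \<longrightarrow> smooth_field A U Y \<longrightarrow> smooth_field A U (D X Y)) \<and>
     (\<forall>U X X' Y f f'. smooth_field A U X \<longrightarrow> smooth_field A U X' \<longrightarrow> smooth_field A U Y \<longrightarrow>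
        smooth_fun A U f \<longrightarrow> smooth_fun A U f' \<longrightarrow>
        (\<forall>p\<in>U. D (\<lambda>q. f q \<odot> X q + f' q \<odot> X' q) Y p = f p \<odot> D X Y p + f' p \<odot> D X' Y p)) \<and>
     (\<forall>U X Y Y'. smooth_field A U X \<longrightarrow> smooth_field A U Y \<longrightarrow> smooth_field A U Y' \<longrightarrow>
        (\<forall>p\<in>U. D X (\<lambda>q. Y q + Y' q) p = D X Y p + D X Y' p)) \<and>
     (\<forall>U X Y f. smooth_field A U X \<longrightarrow> smooth_field A U Y \<longrightarrow> smooth_fun A U f \<longrightarrow>
        (\<forall>p\<in>U. D X (\<lambda>q. f q \<odot> Y q) p = X p f \<odot> Y p + f p \<odot> D X Y p)) \<and>
     (\<forall>U X X' Y Y'. smooth_field A U X \<longrightarrow> smooth_field A U Y \<longrightarrow>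
        (\<forall>p\<in>U. X' p = X p \<and> Y' p = Y p) \<longrightarrow> (\<forall>p\<in>U. D X' Y' p = D X Y p))"

definition levi_civita ::
  "('a::topological_space, 'n::finite) chart set \<Rightarrow> 'a metric_field \<Rightarrow> 'a connection \<Rightarrow> bool" where
  "levi_civita A g D \<longleftrightarrow>
     affine_connection A D \<and>
     (\<forall>U X Y. smooth_field A U X \<longrightarrow> smooth_field A U Y \<longrightarrow>
        (\<forall>p\<in>U. D X Y p - D Y X p = lie_bracket A X Y p)) \<and>
     (\<forall>U X Y Z. smooth_field A U X \<longrightarrow> smooth_field A U Y \<longrightarrow> smooth_field A U Z \<longrightarrow>
        (\<forall>p\<in>U. X p (\<lambda>q. g q (Y q) (Z q)) = g p (D X Y p) (Z p) + g p (Y p) (D X Z p)))"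

definition curvature ::
  "('a::topological_space, 'n::finite) chart set \<Rightarrow> 'a connection
    \<Rightarrow> 'a vfield \<Rightarrow> 'a vfield \<Rightarrow> 'a vfield \<Rightarrow> 'a vfield" where
  "curvature A D X Y Z = (\<lambda>p. D X (D Y Z) p - D Y (D X Z) p - D (lie_bracket A X Y) Z p)"

text \<open>
  The curvature at tangent vectors is computed from smooth local extensions of these vectors; as
  curvature is tensorial, the choice of extensions is immaterial.
\<close>

definition field_extension ::
  "('a::topological_space, 'n::finite) chart set \<Rightarrow> 'a \<Rightarrow> 'a tvec \<Rightarrow> 'a vfield" where
  "field_extension A p v = (SOME X. X p = v \<and> (\<exists>U. p \<in> U \<and> smooth_field A U X))"

definition curvature_tensor ::
  "('a::topological_space, 'n::finite) chart set \<Rightarrow> 'a metric_field \<Rightarrow> 'a connection \<Rightarrow> 'a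
    \<Rightarrow> 'a tvec \<Rightarrow> 'a tvec \<Rightarrow> 'a tvec \<Rightarrow> 'a tvec \<Rightarrow> real" where
  "curvature_tensor A g D p u v w z =
     g p (curvature A D (field_extension A p u) (field_extension A p v) (field_extension A p w) p) z"

definition scalar_curvature ::
  "('b::topological_space, 'm::finite) chart set \<Rightarrow> 'b metric_field \<Rightarrow> 'b connection \<Rightarrow> 'b
    \<Rightarrow> (nat \<Rightarrow> 'b tvec) \<Rightarrow> real" where
  "scalar_curvature A g D p e =
     (\<Sum>(i, j)\<in>{(i, j). 1 \<le> i \<and> i < j \<and> j \<le> CARD('m)}.
        curvature_tensor A g D p (e i) (e j) (e j) (e i))"


section \<open>\<open>(LCS)\<^sub>n\<close>-manifolds\<close>

definition eta :: "'a metric_field \<Rightarrow> 'a vfield \<Rightarrow> 'a \<Rightarrow> 'a tvec \<Rightarrow> real" where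
  "eta g \<xi> p v = g p v (\<xi> p)"

text \<open>
  In the concircularity condition the left-hand side is
  \<open>(\<nabla>\<^sub>X \<eta>)(Y) = X (\<eta> Y) - \<eta> (\<nabla>\<^sub>X Y)\<close>.
\<close>

definition LCS_manifold ::
  "('a::{t2_space, second_countable_topology}, 'n::finite) chart set \<Rightarrow> 'a metric_field
    \<Rightarrow> 'a connection \<Rightarrow> 'a vfield \<Rightarrow> ('a \<Rightarrow> real) \<Rightarrow> bool" where
  "LCS_manifold B g D \<xi> \<alpha> \<longleftrightarrow>
     smooth_manifold B \<and> lorentzian_metric B g \<and> levi_civita B g D \<and>
     smooth_field B UNIV \<xi> \<and> (\<forall>p. g p (\<xi> p) (\<xi> p) = -1) \<and>
     smooth_fun B UNIV \<alpha> \<and> (\<forall>p. \<alpha> p \<noteq> 0) \<and>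
     (\<forall>U X Y. smooth_field B U X \<longrightarrow> smooth_field B U Y \<longrightarrow>
        (\<forall>p\<in>U. X p (\<lambda>q. eta g \<xi> q (Y q)) - eta g \<xi> p (D X Y p)
               = \<alpha> p * (g p (X p) (Y p) + eta g \<xi> p (X p) * eta g \<xi> p (Y p)))) \<and>
     (\<forall>p. \<forall>v\<in>tangent_space B p. v \<alpha> = - (\<xi> p \<alpha>) * eta g \<xi> p v)"

definition structure_tensor ::
  "'a connection \<Rightarrow> 'a vfield \<Rightarrow> ('a \<Rightarrow> real) \<Rightarrow> 'a vfield \<Rightarrow> 'a vfield" where
  "structure_tensor D \<xi> \<alpha> X = (\<lambda>p. (1 / \<alpha> p) \<odot> D X \<xi> p)"

definition quarter_symmetric_connection ::
  "'a metric_field \<Rightarrow> 'a connection \<Rightarrow> 'a vfield \<Rightarrow> ('a \<Rightarrow> real) \<Rightarrow> 'a connection" where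
  "quarter_symmetric_connection g D \<xi> \<alpha> X Y =
     (\<lambda>p. D X Y p + eta g \<xi> p (Y p) \<odot> structure_tensor D \<xi> \<alpha> X p
            - g p (structure_tensor D \<xi> \<alpha> X p) (Y p) \<odot> \<xi> p)"


section \<open>Submanifolds\<close>

definition immersion ::
  "('b::topological_space, 'm::finite) chart set \<Rightarrow> ('a::topological_space, 'n::finite) chart set
    \<Rightarrow> ('b \<Rightarrow> 'a) \<Rightarrow> bool" where
  "immersion A B F \<longleftrightarrow>
     smooth_map A B F \<and> (\<forall>p. inj_on (pushforward B F p) (tangent_space A p))"

definition induced_metric ::
  "('a::topological_space, 'n::finite) chart set \<Rightarrow> ('b \<Rightarrow> 'a) \<Rightarrow> 'a metric_field \<Rightarrow> 'b metric_field" where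
  "induced_metric B F g p u v = g (F p) (pushforward B F p u) (pushforward B F p v)"

definition normal_space ::
  "('b::topological_space, 'm::finite) chart set \<Rightarrow> ('a::topological_space, 'n::finite) chart set
    \<Rightarrow> ('b \<Rightarrow> 'a) \<Rightarrow> 'a metric_field \<Rightarrow> 'b \<Rightarrow> 'a tvec set" where
  "normal_space A B F g p =
     {\<nu> \<in> tangent_space B (F p). \<forall>v\<in>tangent_space A p. g (F p) \<nu> (pushforward B F p v) = 0}"

definition C_totally_real ::
  "('b::topological_space, 'm::finite) chart set \<Rightarrow> ('a::topological_space, 'n::finite) chart set
    \<Rightarrow> ('b \<Rightarrow> 'a) \<Rightarrow> 'a metric_field \<Rightarrow> 'a vfield \<Rightarrow> bool" where
  "C_totally_real A B F g \<xi> \<longleftrightarrow> (\<forall>p. \<xi> (F p) \<in> normal_space A B F g p)"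

text \<open>
  An ambient connection \<open>D\<close> is applied to a vector field \<open>X\<close> on the submanifold and a field \<open>V\<close> of
  ambient vectors along \<open>F\<close> (in particular the image of a tangent field) by the connection along
  \<open>F\<close>: in an ambient chart around \<open>F p\<close>, with \<open>V = \<Sum>\<^sub>k V\<^sup>k (\<partial>\<^sub>k \<circ> F)\<close> and
  \<open>dF(X) = \<Sum>\<^sub>i (dF X)\<^sup>i \<partial>\<^sub>i\<close>, its value is
  \<open>\<Sum>\<^sub>k X(V\<^sup>k) \<partial>\<^sub>k + \<Sum>\<^sub>i\<^sub>k (dF X)\<^sup>i V\<^sup>k D\<^bsub>\<partial>\<^sub>i\<^esub> \<partial>\<^sub>k\<close>. It does not depend on the chart, and if \<open>V\<close>
  and \<open>dF(X)\<close> are restrictions of ambient fields \<open>V'\<close> and \<open>X'\<close>, it is the restriction of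
  \<open>D X' V'\<close>.
\<close>

definition connection_along ::
  "('a::topological_space, 'n::finite) chart set \<Rightarrow> ('b \<Rightarrow> 'a) \<Rightarrow> 'a connection
    \<Rightarrow> 'b vfield \<Rightarrow> ('b \<Rightarrow> 'a tvec) \<Rightarrow> 'b \<Rightarrow> 'a tvec" where
  "connection_along B F D X V p =
     (let c = (SOME c. c \<in> B \<and> F p \<in> fst c);
          coord = (\<lambda>k x. snd c x $ k);
          E = coord_field B c
      in \<Sum>k\<in>UNIV. X p (\<lambda>q. V q (coord k)) \<odot> E k (F p)
           + (\<Sum>i\<in>UNIV. (pushforward B F p (X p) (coord i) * V p (coord k)) \<odot> D (E i) (E k) (F p)))"

text \<open>
  The Gauss formula: \<open>D'\<close> is the tangential part and \<open>h\<close> the normal part of the ambient connection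
  \<open>D\<close>, i.e. \<open>D'\<close> is the connection induced by \<open>D\<close>, with second fundamental form \<open>h\<close>.
\<close>

definition gauss_formula ::
  "('b::topological_space, 'm::finite) chart set \<Rightarrow> ('a::topological_space, 'n::finite) chart set
    \<Rightarrow> ('b \<Rightarrow> 'a) \<Rightarrow> 'a metric_field \<Rightarrow> 'a connection
    \<Rightarrow> 'b connection \<Rightarrow> ('b vfield \<Rightarrow> 'b vfield \<Rightarrow> 'b \<Rightarrow> 'a tvec) \<Rightarrow> bool" where
  "gauss_formula A B F g D D' h \<longleftrightarrow>
     (\<forall>U X Y. smooth_field A U X \<longrightarrow> smooth_field A U Y \<longrightarrow> (\<forall>p\<in>U.
        D' X Y p \<in> tangent_space A p \<and> h X Y p \<in> normal_space A B F g p \<and>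
        connection_along B F D X (\<lambda>q. pushforward B F q (Y q)) p
          = pushforward B F p (D' X Y p) + h X Y p))"

end

theory Submission
  imports Defs
begin

text \<open>
  On a \<open>C\<close>-totally real submanifold \<open>\<eta>\<close> vanishes on tangent vectors, so for tangent fields \<open>X\<close>, \<open>Y\<close>
  the quarter symmetric and the Levi-Civita connection of the ambient manifold differ only by
  \<open>- g (\<phi> X, Y) \<xi>\<close>, which is normal. Tangent vectors of the submanifold are orthogonal to the timelike
  \<open>\<xi>\<close>, hence the induced metric is definite and tangential parts are unique. So the two induced
  connections coincide, and with them their curvatures.
\<close>

section \<open>Calculus of smooth maps\<close>

text \<open>The formula for the difference of the two ambient connections does not apply to
  \<open>X\<close> and \<open>Y\<close> directly, as these live on the submanifold.
  \<open>connection_along\<close> works with the coordinate fields of an ambient chart, on which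
  \<eta> need not vanish; the \<eta> term disappears only after summation against the components of
  the field. The difference of two candidate tangential parts is orthogonal to itself, but a
  Lorentzian metric has nonzero null vectors; orthogonality to \<xi> excludes them. Curvature
  differentiates twice, so the connections are compared on whole open sets and not just at one
  point. The second induced connection is given only by its Gauss formula; smoothness and locality
  are borrowed from the Levi-Civita connection. As tangent vectors are velocities of curves and
  curvature is evaluated on chosen extensions, charts have to supply the linear structure, the
  pushforwards and the local extensions.\<close>

lemma Ck_on_subset: "Ck_on k S f \<Longrightarrow> T \<subseteq> S \<Longrightarrow> Ck_on k T f"
  by (induction k arbitrary: f) (auto intro: continuous_on_subset)

text \<open>Openness of \<open>S\<close> matters because derivatives are taken \<open>at x\<close>
  in the full space and see the values in a neighbourhood.\<close>

lemma Ck_on_cong: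
  assumes "open S" "\<And>x. x \<in> S \<Longrightarrow> f x = g x"
  shows "Ck_on k S f \<longleftrightarrow> Ck_on k S g"
  using assms(2)
proof (induction k arbitrary: f g)
  case 0
  then show ?case by (simp cong: continuous_on_cong)
next
  case (Suc k)
  have D: "(f has_derivative f') (at x) \<longleftrightarrow> (g has_derivative f') (at x)" if "x \<in> S" for x f'
    using has_derivative_transform_within_open[OF _ assms(1) that] Suc.prems by metis
  have "frechet_derivative f (at x) = frechet_derivative g (at x)" if "x \<in> S" for x
    unfolding frechet_derivative_def using D[OF that] by simp
  moreover have "f differentiable (at x) \<longleftrightarrow> g differentiable (at x)" if "x \<in> S" for x
    unfolding differentiable_def using D[OF that] by simp
  ultimately show ?case
    using Suc.IH[of "\<lambda>x. frechet_derivative f (at x) v" "\<lambda>x. frechet_derivative g (at x) v" for v]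
    by simp
qed

text \<open>For use where the chart, and with it the neighbourhood, depends on the point.\<close>

lemma Ck_on_local:
  assumes "\<And>x. x \<in> S \<Longrightarrow> \<exists>T. open T \<and> x \<in> T \<and> Ck_on k T f"
  shows "Ck_on k S f"
  using assms
proof (induction k arbitrary: f)
  case 0
  then show ?case
    by (auto intro!: continuous_at_imp_continuous_on simp: continuous_on_eq_continuous_at) 
       (metis continuous_on_eq_continuous_at)
next
  case (Suc k)
  then show ?case by (fastforce intro!: Suc.IH)
qed

lemma Ck_on_imp_continuous_on: "Ck_on k S f \<Longrightarrow> continuous_on S f"
  by (cases k) (auto intro!: continuous_at_imp_continuous_on differentiable_imp_continuous_within)

lemma Ck_on_SucD: "Ck_on (Suc k) S f \<Longrightarrow> Ck_on k S f"
proof (induction k arbitrary: f)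
  case 0
  then show ?case using Ck_on_imp_continuous_on by (metis Ck_on.simps(1))
next
  case (Suc k)
  have "f differentiable (at x)" if "x \<in> S" for x
    using Suc.prems that unfolding Ck_on.simps(2)[of "Suc k"] by blast
  moreover have "Ck_on k S (\<lambda>x. frechet_derivative f (at x) v)" for v
    using Suc.prems unfolding Ck_on.simps(2)[of "Suc k"] by (blast intro: Suc.IH)
  ultimately show ?case by simp
qed

text \<open>By uniqueness of derivatives an explicit formula \<open>f'\<close> may replace
  \<open>frechet_derivative\<close>; most closure properties below are inductions through this
  rule.\<close>

lemma Ck_on_SucI:
  assumes "open S" "\<And>x. x \<in> S \<Longrightarrow> (f has_derivative f' x) (at x)"
    "\<And>v. Ck_on k S (\<lambda>x. f' x v)"
  shows "Ck_on (Suc k) S f"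
proof -
  have "Ck_on k S (\<lambda>x. frechet_derivative f (at x) v)" for v
    using assms(3)[of v] frechet_derivative_at[OF assms(2)]
    by (subst Ck_on_cong[OF assms(1), where g = "\<lambda>x. f' x v"]) auto
  then show ?thesis using assms(2) by (auto simp: differentiable_def)
qed

lemma Ck_on_Suc_has_derivative:
  "Ck_on (Suc k) S f \<Longrightarrow> x \<in> S \<Longrightarrow> (f has_derivative frechet_derivative f (at x)) (at x)"
  by (simp add: frechet_derivative_works)

lemma Ck_on_const: "open S \<Longrightarrow> Ck_on k S (\<lambda>x. c)"
  by (induction k arbitrary: c) (auto intro: Ck_on_SucI[where f' = "\<lambda>x v. 0"] simp del: Ck_on.simps(2))

lemma Ck_on_linear: "open S \<Longrightarrow> bounded_linear f \<Longrightarrow> Ck_on k S f"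
  by (cases k) (auto intro!: Ck_on_SucI[where f' = "\<lambda>x. f"] Ck_on_const bounded_linear_imp_has_derivative
      simp del: Ck_on.simps(2) simp: linear_continuous_on)

lemma Ck_on_add:
  "open S \<Longrightarrow> Ck_on k S f \<Longrightarrow> Ck_on k S g \<Longrightarrow> Ck_on k S (\<lambda>x. f x + g x)"
proof (induction k arbitrary: f g)
  case 0
  then show ?case by (simp add: continuous_on_add)
next
  case (Suc k)
  show ?case
    by (rule Ck_on_SucI[OF \<open>open S\<close> has_derivative_add[OF Ck_on_Suc_has_derivative[OF Suc.prems(2)]
          Ck_on_Suc_has_derivative[OF Suc.prems(3)]]]) (use Suc in auto)
qed

lemma Ck_on_scaleR:
  fixes f :: "'v::real_normed_vector \<Rightarrow> real"
  shows "open S \<Longrightarrow> Ck_on k S f \<Longrightarrow> Ck_on k S g \<Longrightarrow> Ck_on k S (\<lambda>x. f x *\<^sub>R g x)"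
proof (induction k arbitrary: f g)
  case 0
  then show ?case by (simp add: continuous_on_scaleR)
next
  case (Suc k)
  note Ck_on.simps(2)[simp del]
  have "Ck_on k S (\<lambda>x. frechet_derivative f (at x) v)" "Ck_on k S (\<lambda>x. frechet_derivative g (at x) v)" for v
    using Suc.prems by (auto simp: Ck_on.simps(2))
  \<comment> \<open>The product rule also contains \<open>f\<close> and \<open>g\<close>
    undifferentiated; \<open>Ck_on_SucD\<close> lowers them to order \<open>k\<close>.\<close>
  then show ?case
    by (intro Ck_on_SucI[OF \<open>open S\<close> has_derivative_scaleR[OF Ck_on_Suc_has_derivative[OF Suc.prems(2)]
          Ck_on_Suc_has_derivative[OF Suc.prems(3)]]] Ck_on_add Suc.IH) (use \<open>open S\<close> Ck_on_SucD[OF Suc.prems(2)] Ck_on_SucD[OF Suc.prems(3)] in simp_all)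
qed

lemma Ck_on_sum:
  "finite I \<Longrightarrow> open S \<Longrightarrow> (\<And>i. i \<in> I \<Longrightarrow> Ck_on k S (f i)) \<Longrightarrow> Ck_on k S (\<lambda>x. \<Sum>i\<in>I. f i x)"
  by (induction I rule: finite_induct) (simp_all add: Ck_on_const Ck_on_add)

lemma Ck_on_bounded_linear:
  "open S \<Longrightarrow> bounded_linear L \<Longrightarrow> Ck_on k S f \<Longrightarrow> Ck_on k S (\<lambda>x. L (f x))"
proof (induction k arbitrary: f)
  case 0
  then show ?case by (simp add: bounded_linear.continuous_on)
next
  case (Suc k)
  show ?case
    by (rule Ck_on_SucI[OF \<open>open S\<close> bounded_linear.has_derivative[OF Suc.prems(2)
          Ck_on_Suc_has_derivative[OF Suc.prems(3)]]]) (use Suc in auto)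
qed

text \<open>\<open>Ck_on\<close> controls derivatives in fixed directions only, whereas in the chain
  rule the direction \<open>?f x v\<close> moves with \<open>x\<close>. Expanding it in the basis
  leaves products of a scalar function with a derivative of \<open>g\<close> in a fixed direction;
  this is where a Euclidean middle space enters.\<close>

lemma Ck_on_compose:
  fixes f :: "'v::real_normed_vector \<Rightarrow> 'w::euclidean_space"
  assumes "open S" "open T" "f ` S \<subseteq> T"
  shows "Ck_on k T g \<Longrightarrow> Ck_on k S f \<Longrightarrow> Ck_on k S (g \<circ> f)"
proof (induction k arbitrary: g)
  case 0
  then have "continuous_on T g" "continuous_on S f" by simp_all
  then have "continuous_on S (g \<circ> f)"
    by (intro continuous_on_compose continuous_on_subset[OF _ assms(3)])
  then show ?case by simp
next
  case (Suc k)
  let ?f = "\<lambda>x. frechet_derivative f (at x)" and ?g = "\<lambda>y. frechet_derivative g (at y)"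
  show ?case
  proof (rule Ck_on_SucI[OF \<open>open S\<close>])
    fix x assume "x \<in> S"
    then have g: "(g has_derivative ?g (f x)) (at (f x))"
      using Ck_on_Suc_has_derivative[OF Suc.prems(1)] assms(3) by blast
    interpret G: bounded_linear "?g (f x)" using g by (rule has_derivative_bounded_linear)
    have "?g (f x) (?f x v) = (\<Sum>b\<in>Basis. (?f x v \<bullet> b) *\<^sub>R ?g (f x) b)" for v
      by (subst euclidean_representation[of "?f x v", symmetric]) (simp only: G.sum G.scaleR)
    then show "(g \<circ> f has_derivative (\<lambda>v. \<Sum>b\<in>Basis. (?f x v \<bullet> b) *\<^sub>R ?g (f x) b)) (at x)"
      using diff_chain_at[OF Ck_on_Suc_has_derivative[OF Suc.prems(2) \<open>x \<in> S\<close>] g] by (simp add: o_def)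
  next
    fix v
    have "Ck_on k S (\<lambda>x. ?f x v \<bullet> b)" for b
      using Suc.prems(2) by (intro Ck_on_bounded_linear[OF \<open>open S\<close> bounded_linear_inner_left]) simp
    moreover have "Ck_on k S ((\<lambda>y. ?g y b) \<circ> f)" for b
      using Suc.prems(1) by (intro Suc.IH Ck_on_SucD[OF Suc.prems(2)]) simp
    ultimately show "Ck_on k S (\<lambda>x. \<Sum>b\<in>Basis. (?f x v \<bullet> b) *\<^sub>R ?g (f x) b)"
      using \<open>open S\<close> by (auto intro!: Ck_on_sum Ck_on_scaleR simp: o_def)

  qed
qed

lemma smooth_on_differentiable: "smooth_on S f \<Longrightarrow> x \<in> S \<Longrightarrow> f differentiable (at x)"
  unfolding smooth_on_def by (metis Ck_on.simps(2))

lemma smooth_on_frechet_derivative: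
  "smooth_on S f \<Longrightarrow> smooth_on S (\<lambda>x. frechet_derivative f (at x) v)"
  unfolding smooth_on_def by (metis Ck_on.simps(2))

lemma smooth_on_cong:
  assumes "open S" "\<And>x. x \<in> S \<Longrightarrow> f x = g x"
  shows "smooth_on S f \<longleftrightarrow> smooth_on S g"
proof -
  have "Ck_on k S f \<longleftrightarrow> Ck_on k S g" for k
    using assms by (rule Ck_on_cong)
  then show ?thesis by (simp add: smooth_on_def)
qed

lemma smooth_on_compose:
  fixes f :: "'v::real_normed_vector \<Rightarrow> 'w::euclidean_space"
  assumes "open S" "open T" "f ` S \<subseteq> T" "smooth_on T g" "smooth_on S f"
  shows "smooth_on S (g \<circ> f)"
  using assms by (simp add: smooth_on_def Ck_on_compose)

lemma smooth_on_subset: "smooth_on S f \<Longrightarrow> T \<subseteq> S \<Longrightarrow> smooth_on T f"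
  unfolding smooth_on_def using Ck_on_subset by blast

lemma smooth_on_local:
  assumes "\<And>x. x \<in> S \<Longrightarrow> \<exists>T. open T \<and> x \<in> T \<and> smooth_on T f"
  shows "smooth_on S f"
  using assms unfolding smooth_on_def by (meson Ck_on_local)

lemma smooth_on_diff:
  fixes f g :: "'v::real_normed_vector \<Rightarrow> 'w::real_normed_vector"
  assumes "open S" "smooth_on S f" "smooth_on S g"
  shows "smooth_on S (\<lambda>x. f x - g x)"
proof -
  have "Ck_on k S (\<lambda>x. f x + - g x)" for k
    using assms by (intro Ck_on_add Ck_on_bounded_linear[where L = uminus] bounded_linear_minus
        bounded_linear_ident) (auto simp: smooth_on_def)
  then show ?thesis by (simp add: smooth_on_def)
qed

section \<open>Tangent vectors in coordinates\<close>

lemma sum_fun_apply: "(\<Sum>i\<in>I. f i) x = (\<Sum>i\<in>I. f i x)"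
  by (induction I rule: infinite_finite_induct) auto

interpretation tvec: vector_space tscale
  by unfold_locales (auto simp: tscale_def fun_eq_iff algebra_simps)

lemma tscale_apply: "(a \<odot> v) f = a * v f"
  by (simp add: tscale_def)

text \<open>The field with constant components \<open>a\<close> in the chart. Allowing every
  direction, not only the axes as in \<open>coord_field\<close>, makes the tangent space at a point
  of the chart the range of a linear map.\<close>

definition chart_vec ::
  "('a::topological_space, 'n::finite) chart set \<Rightarrow> ('a, 'n) chart \<Rightarrow> real ^ 'n \<Rightarrow> 'a vfield" where
  "chart_vec A c a = (\<lambda>p f. if smooth_near A p f
     then frechet_derivative (f \<circ> inv_into (fst c) (snd c)) (at (snd c p)) a else 0)"

lemma coord_field_eq_chart_vec: "coord_field A c k = chart_vec A c (axis k 1)"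
  by (simp add: coord_field_def chart_vec_def case_prod_unfold)

lemma smooth_fun_cong:
  assumes "\<And>p. p \<in> U \<Longrightarrow> f p = f' p"
    and "\<And>V \<phi>. (V, \<phi>) \<in> A \<Longrightarrow> open (\<phi> ` (U \<inter> V))"
    and "\<And>V \<phi> p. (V, \<phi>) \<in> A \<Longrightarrow> p \<in> V \<Longrightarrow> inv_into V \<phi> (\<phi> p) = p"
  shows "smooth_fun A U f \<longleftrightarrow> smooth_fun A U f'"
proof -
  have "smooth_on (\<phi> ` (U \<inter> V)) (f \<circ> inv_into V \<phi>) \<longleftrightarrow> smooth_on (\<phi> ` (U \<inter> V)) (f' \<circ> inv_into V \<phi>)"
    if "(V, \<phi>) \<in> A" for V \<phi>
    using assms that by (intro smooth_on_cong) auto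
  then show ?thesis unfolding smooth_fun_def by auto
qed

section \<open>Charts of a smooth manifold\<close>

context
  fixes A :: "('a::{t2_space, second_countable_topology}, 'n::finite) chart set"
  assumes A: "smooth_manifold A"
begin

lemma ex_chart: "\<exists>V \<phi>. (V, \<phi>) \<in> A \<and> p \<in> V"
  using A unfolding smooth_manifold_def by (metis (no_types, lifting) UNIV_I UN_E case_prod_conv surj_pair)

lemma transition_smooth:
  "(U, \<phi>) \<in> A \<Longrightarrow> (V, \<psi>) \<in> A \<Longrightarrow> smooth_on (\<phi> ` (U \<inter> V)) (\<psi> \<circ> inv_into U \<phi>)"
  using A unfolding smooth_manifold_def by fast

context
  fixes V \<phi>
  assumes c: "(V, \<phi>) \<in> A"
begin

lemma chart_open: "open V"
  using A c unfolding smooth_manifold_def by fast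

lemma chart_homeomorphism: "homeomorphism V (\<phi> ` V) \<phi> (inv_into V \<phi>)"
  using A c unfolding smooth_manifold_def by fast

lemma chart_inverse: "p \<in> V \<Longrightarrow> inv_into V \<phi> (\<phi> p) = p"
  using chart_homeomorphism by (simp add: homeomorphism_apply1)

lemma chart_image_Int: "\<phi> ` (W \<inter> V) = inv_into V \<phi> -` W \<inter> \<phi> ` V"
  by (auto simp: chart_inverse)

lemma chart_image_open: "open W \<Longrightarrow> open (\<phi> ` (W \<inter> V))"
  unfolding chart_image_Int
  using A c homeomorphism_cont2[OF chart_homeomorphism]
  by (auto simp: smooth_manifold_def Int_commute intro!: continuous_open_preimage)

lemma open_chart_image: "open (\<phi> ` V)"
  using chart_image_open[of UNIV] by simp

end

lemma smooth_fun_open_image: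
  "(V, \<phi>) \<in> A \<Longrightarrow> smooth_fun A W f \<Longrightarrow> open (\<phi> ` (W \<inter> V))"
  by (simp add: chart_image_open smooth_fun_def)

text \<open>Tangent vectors are set to zero on functions that are not smooth, so components can be
  read off with the coordinate functions only once these are known to be smooth.\<close>

lemma smooth_fun_coord:
  assumes c: "(V, \<phi>) \<in> A"
  shows "smooth_fun A V (\<lambda>x. \<phi> x $ k)"
proof -
  have "smooth_on (\<psi> ` (V \<inter> W)) ((\<lambda>x. \<phi> x $ k) \<circ> inv_into W \<psi>)" if W: "(W, \<psi>) \<in> A" for W \<psi>
  proof -
    have "smooth_on (\<psi> ` (V \<inter> W)) ((\<lambda>y. y $ k) \<circ> (\<phi> \<circ> inv_into W \<psi>))"
      using transition_smooth[OF W c]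
      by (intro smooth_on_compose[OF chart_image_open[OF W chart_open[OF c]] open_UNIV])
        (auto simp: smooth_on_def Int_commute intro: Ck_on_linear bounded_linear_vec_nth)
    then show ?thesis by (simp add: o_def)
  qed
  then show ?thesis by (auto simp: smooth_fun_def chart_open[OF c])
qed

lemma smooth_near_differentiable:
  assumes c: "(V, \<phi>) \<in> A" "p \<in> V" and "smooth_near A p f"
  shows "(f \<circ> inv_into V \<phi>) differentiable (at (\<phi> p))"
  using assms by (auto simp: smooth_near_def smooth_fun_def intro!: smooth_on_differentiable[of "\<phi> ` (_ \<inter> V)"])

section \<open>Tangent spaces as ranges of chart vectors\<close>

context
  fixes V \<phi> p
  assumes c: "(V, \<phi>) \<in> A" "p \<in> V"
begin

lemma chart_vec_add: "chart_vec A (V, \<phi>) (a + b) p = chart_vec A (V, \<phi>) a p + chart_vec A (V, \<phi>) b p"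
  using linear_frechet_derivative[OF smooth_near_differentiable[OF c]]
  by (auto simp: chart_vec_def fun_eq_iff linear_add)

lemma chart_vec_scale: "chart_vec A (V, \<phi>) (r *\<^sub>R a) p = r \<odot> chart_vec A (V, \<phi>) a p"
  using linear_frechet_derivative[OF smooth_near_differentiable[OF c]]
  by (auto simp: chart_vec_def fun_eq_iff tscale_def linear_scale)

lemma chart_vec_0: "chart_vec A (V, \<phi>) 0 p = 0"
  using chart_vec_scale[of 0 0] by simp

lemma chart_vec_expand: "chart_vec A (V, \<phi>) a p = (\<Sum>k\<in>UNIV. a $ k \<odot> coord_field A (V, \<phi>) k p)"
proof -
  have "chart_vec A (V, \<phi>) (\<Sum>k\<in>K. a $ k *\<^sub>R axis k 1) p
      = (\<Sum>k\<in>K. a $ k \<odot> coord_field A (V, \<phi>) k p)" for K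
    by (induction K rule: infinite_finite_induct)
      (simp_all add: chart_vec_0 chart_vec_add chart_vec_scale coord_field_eq_chart_vec)
  from this[of UNIV] show ?thesis by (simp add: basis_expansion[of a, unfolded vector_smult_lid] flip: scalar_mult_eq_scaleR)
qed

lemma chart_vec_coord: "chart_vec A (V, \<phi>) a p (\<lambda>x. \<phi> x $ k) = a $ k"
proof -
  have "((\<lambda>y. y $ k) has_derivative (\<lambda>v. v $ k)) (at (\<phi> p))"
    by (rule bounded_linear_imp_has_derivative[OF bounded_linear_vec_nth])
  then have "((\<lambda>x. \<phi> x $ k) \<circ> inv_into V \<phi> has_derivative (\<lambda>v. v $ k)) (at (\<phi> p))"
    by (rule has_derivative_transform_within_open[OF _ open_chart_image[OF c(1)]])
      (use c chart_inverse[OF c(1)] in auto)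
  then have "frechet_derivative ((\<lambda>x. \<phi> x $ k) \<circ> inv_into V \<phi>) (at (\<phi> p)) = (\<lambda>v. v $ k)"
    by (simp add: frechet_derivative_at[symmetric])
  moreover have "smooth_near A p (\<lambda>x. \<phi> x $ k)"
    using smooth_fun_coord[OF c(1)] c by (auto simp: smooth_near_def)
  ultimately show ?thesis by (simp add: chart_vec_def)
qed

text \<open>Near \<open>0\<close> the function \<open>f \<circ> \<gamma>\<close> factors through the
  chart as \<open>(f \<circ> inv_into V \<phi>) \<circ> (\<phi> \<circ> \<gamma>)\<close>, so the
  chain rule applies.\<close>

lemma velocity_eq_chart_vec:
  assumes "smooth_curve A \<gamma>" "\<gamma> 0 = p"
  shows "velocity A \<gamma> = chart_vec A (V, \<phi>) (frechet_derivative (\<phi> \<circ> \<gamma>) (at 0) 1) p"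
proof
  fix f
  obtain \<epsilon> where \<epsilon>: "\<epsilon> > 0" "continuous_on {-\<epsilon><..<\<epsilon>} \<gamma>"
    and sm: "smooth_on ({-\<epsilon><..<\<epsilon>} \<inter> \<gamma> -` V) (\<phi> \<circ> \<gamma>)"
    using assms(1) c(1) unfolding smooth_curve_def by fast
  let ?I = "{-\<epsilon><..<\<epsilon>} \<inter> \<gamma> -` V"
  have I: "open ?I" "0 \<in> ?I"
    using \<epsilon> c assms(2) chart_open[OF c(1)] by (auto simp: continuous_on_open_vimage Int_commute)
  show "velocity A \<gamma> f = chart_vec A (V, \<phi>) (frechet_derivative (\<phi> \<circ> \<gamma>) (at 0) 1) p f"
  proof (cases "smooth_near A p f")
    case True
    let ?g = "f \<circ> inv_into V \<phi>"
    have \<gamma>: "((\<phi> \<circ> \<gamma>) has_derivative frechet_derivative (\<phi> \<circ> \<gamma>) (at 0)) (at 0)"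
      using smooth_on_differentiable[OF sm I(2)] by (simp add: frechet_derivative_works)
    have "(?g has_derivative frechet_derivative ?g (at (\<phi> p))) (at ((\<phi> \<circ> \<gamma>) 0))"
      using smooth_near_differentiable[OF c True] assms(2) by (simp add: frechet_derivative_works)
    from diff_chain_at[OF \<gamma> this]
    have d: "((f \<circ> \<gamma>) has_derivative frechet_derivative ?g (at (\<phi> p)) \<circ> frechet_derivative (\<phi> \<circ> \<gamma>) (at 0)) (at 0)"
      by (rule has_derivative_transform_within_open[OF _ I]) (use chart_inverse[OF c(1)] in auto)
    let ?L = "frechet_derivative ?g (at (\<phi> p)) \<circ> frechet_derivative (\<phi> \<circ> \<gamma>) (at 0)"
    interpret L: bounded_linear ?L using d by (rule has_derivative_bounded_linear)
    \<comment> \<open>A linear map on the reals is multiplication by its value at \<open>1\<close>;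
      this converts the Frechet derivative into the one that \<open>deriv\<close> returns.\<close>
    have "?L t = ?L 1 * t" for t
      using L.scale[of t 1] by (simp add: mult.commute)
    then have "?L = (*) (?L 1)" by blast
    with d have "((f \<circ> \<gamma>) has_field_derivative ?L 1) (at 0)"
      by (simp only: has_field_derivative_def)
    then show ?thesis
      using True assms(2) by (simp add: velocity_def chart_vec_def DERIV_imp_deriv)
  qed (use assms(2) in \<open>simp add: velocity_def chart_vec_def\<close>)
qed

lemma chart_vec_in_tangent_space: "chart_vec A (V, \<phi>) a p \<in> tangent_space A p"
proof -
  \<comment> \<open>The witness is a straight line in the chart; \<epsilon> below is small enough to
    keep it inside the image of the chart.\<close>
  let ?l = "\<lambda>t::real. \<phi> p + t *\<^sub>R a"
  define \<gamma> where "\<gamma> = inv_into V \<phi> \<circ> ?l"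
  have l: "continuous_on S ?l" for S by (intro continuous_intros)
  have "open (?l -` (\<phi> ` V))" "0 \<in> ?l -` (\<phi> ` V)"
    using open_chart_image[OF c(1)] c(2) l[of UNIV] by (auto simp: continuous_on_open_vimage)
  then obtain \<epsilon> where \<epsilon>: "\<epsilon> > 0" "ball 0 \<epsilon> \<subseteq> ?l -` (\<phi> ` V)"
    by (rule openE)
  let ?I = "{-\<epsilon><..<\<epsilon>}"
  have I: "?l t \<in> \<phi> ` V" if "t \<in> ?I" for t
    using subsetD[OF \<epsilon>(2), of t] that by (simp add: abs_less_iff)
  have l_smooth: "smooth_on S ?l" if "open S" for S
    unfolding smooth_on_def using that
    by (intro allI Ck_on_add Ck_on_const Ck_on_linear bounded_linear_scaleR_left)
  have cont: "continuous_on ?I \<gamma>"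
    unfolding \<gamma>_def using I
    by (intro continuous_on_compose[OF l]
        continuous_on_subset[OF homeomorphism_cont2[OF chart_homeomorphism[OF c(1)]]] image_subsetI)
  \<comment> \<open>\<open>smooth_curve\<close> asks for smoothness in every chart; composing the
    line with a transition map provides it.\<close>
  have "smooth_on (?I \<inter> \<gamma> -` W) (\<psi> \<circ> \<gamma>)" if W: "(W, \<psi>) \<in> A" for W \<psi>
  proof -
    have "open (?I \<inter> \<gamma> -` W)"
      using cont chart_open[OF W] by (simp add: continuous_on_open_vimage Int_commute)
    moreover have "?l ` (?I \<inter> \<gamma> -` W) \<subseteq> \<phi> ` (W \<inter> V)"
      unfolding chart_image_Int[OF c(1)] using I by (auto simp: \<gamma>_def)
    ultimately have "smooth_on (?I \<inter> \<gamma> -` W) ((\<psi> \<circ> inv_into V \<phi>) \<circ> ?l)"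
      using transition_smooth[OF c(1) W] chart_image_open[OF c(1) chart_open[OF W]]
      by (intro smooth_on_compose l_smooth) (auto simp: Int_commute)
    then show ?thesis by (simp add: \<gamma>_def o_assoc)
  qed
  then have \<gamma>: "smooth_curve A \<gamma>" unfolding smooth_curve_def using \<epsilon>(1) cont by auto
  have \<gamma>0: "\<gamma> 0 = p" by (simp add: \<gamma>_def chart_inverse[OF c])
  have "(?l has_derivative (\<lambda>t. t *\<^sub>R a)) (at 0)" by (auto intro!: derivative_eq_intros)
  then have "((\<phi> \<circ> \<gamma>) has_derivative (\<lambda>t. t *\<^sub>R a)) (at 0)"
    by (rule has_derivative_transform_within_open[OF _ open_greaterThanLessThan[of "-\<epsilon>" \<epsilon>]])
      (use \<epsilon> I in \<open>auto simp: \<gamma>_def f_inv_into_f\<close>)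
  then have "frechet_derivative (\<phi> \<circ> \<gamma>) (at 0) = (\<lambda>t. t *\<^sub>R a)"
    by (simp add: frechet_derivative_at[symmetric])
  then have "velocity A \<gamma> = chart_vec A (V, \<phi>) a p"
    using velocity_eq_chart_vec[OF \<gamma> \<gamma>0] by simp
  then show ?thesis unfolding tangent_space_def using \<gamma> \<gamma>0 by force
qed

lemma tangent_space_eq: "tangent_space A p = range (\<lambda>a. chart_vec A (V, \<phi>) a p)"
  using chart_vec_in_tangent_space velocity_eq_chart_vec unfolding tangent_space_def by blast

lemma tangent_vector_expand:
  assumes "v \<in> tangent_space A p"
  shows "v = (\<Sum>k\<in>UNIV. v (\<lambda>x. \<phi> x $ k) \<odot> coord_field A (V, \<phi>) k p)"
proof -
  obtain a where "v = chart_vec A (V, \<phi>) a p" using assms by (auto simp: tangent_space_eq)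
  then show ?thesis using chart_vec_coord chart_vec_expand by simp
qed

lemma coord_field_in_tangent_space: "coord_field A (V, \<phi>) k p \<in> tangent_space A p"
  by (simp add: coord_field_eq_chart_vec chart_vec_in_tangent_space)

end

text \<open>Velocities of curves have no evident sum; linearity comes from the parametrisation by
  the vectors \<open>a\<close> in one chart.\<close>

lemma subspace_tangent_space: "tvec.subspace (tangent_space A p)"
proof -
  obtain V \<phi> where c: "(V, \<phi>) \<in> A" "p \<in> V" using ex_chart by blast
  show ?thesis
    unfolding tangent_space_eq[OF c] tvec.subspace_def
    by (auto simp flip: chart_vec_add[OF c] chart_vec_scale[OF c] intro: chart_vec_0[OF c, symmetric])
qed

section \<open>Smooth fields on open sets\<close>

lemma smooth_field_chart_vec:
  assumes c: "(V, \<phi>) \<in> A"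
  shows "smooth_field A V (chart_vec A (V, \<phi>) a)"
proof -
  have "smooth_fun A W (\<lambda>p. chart_vec A (V, \<phi>) a p f)" if W: "W \<subseteq> V" "smooth_fun A W f" for W f
  proof -
    have "open W" using W(2) by (simp add: smooth_fun_def)
    have "smooth_on (\<psi> ` (W \<inter> V')) ((\<lambda>p. chart_vec A (V, \<phi>) a p f) \<circ> inv_into V' \<psi>)"
      if c': "(V', \<psi>) \<in> A" for V' \<psi>
    proof -
      \<comment> \<open>\<open>?D\<close> expresses the derivative of \<open>f\<close> along the
        field in the chart of the field itself; the transition map carries it over to
        \<psi>.\<close>
      let ?D = "\<lambda>y. frechet_derivative (f \<circ> inv_into V \<phi>) (at y) a"
      have "smooth_on (\<phi> ` (W \<inter> V)) ?D"
        using W(2) c by (intro smooth_on_frechet_derivative) (auto simp: smooth_fun_def)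
      moreover have "smooth_on (\<psi> ` (W \<inter> V')) (\<phi> \<circ> inv_into V' \<psi>)"
        by (rule smooth_on_subset[OF transition_smooth[OF c' c]]) (use W in auto)
      ultimately have "smooth_on (\<psi> ` (W \<inter> V')) (?D \<circ> (\<phi> \<circ> inv_into V' \<psi>))"
        using W c c' \<open>open W\<close>
        by (intro smooth_on_compose[where T = "\<phi> ` (W \<inter> V)"] chart_image_open) (auto simp: chart_inverse)
      then show ?thesis
        by (subst smooth_on_cong[OF chart_image_open[OF c' \<open>open W\<close>], where g = "?D \<circ> (\<phi> \<circ> inv_into V' \<psi>)"])
          (use W in \<open>auto simp: chart_inverse[OF c'] chart_vec_def smooth_near_def\<close>)
    qed
    then show ?thesis using W by (auto simp: smooth_fun_def)
  qed
  then show ?thesis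
    by (auto simp: smooth_field_def chart_open[OF c] chart_vec_in_tangent_space[OF c])
qed

lemma ex_field_extension:
  assumes "v \<in> tangent_space A p"
  shows "\<exists>X U. X p = v \<and> p \<in> U \<and> smooth_field A U X"
proof -
  obtain V \<phi> where c: "(V, \<phi>) \<in> A" "p \<in> V" using ex_chart by blast
  with assms obtain a where "v = chart_vec A (V, \<phi>) a p" by (auto simp: tangent_space_eq)
  then show ?thesis using smooth_field_chart_vec[OF c(1)] c(2) by blast
qed

text \<open>The choice in the definition of the same name is meaningful because a field with
  constant components in a chart is a candidate.\<close>

lemma field_extension:
  assumes "v \<in> tangent_space A p"
  obtains U where "p \<in> U" "smooth_field A U (field_extension A p v)"
  using someI_ex[of "\<lambda>X. X p = v \<and> (\<exists>U. p \<in> U \<and> smooth_field A U X)"] ex_field_extension[OF assms]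
  unfolding field_extension_def by blast

lemma smooth_field_subset: "smooth_field A U X \<Longrightarrow> open W \<Longrightarrow> W \<subseteq> U \<Longrightarrow> smooth_field A W X"
  unfolding smooth_field_def by (meson subset_iff subset_trans)

text \<open>It passes smoothness on to fields known only through equations on \<open>U\<close>:
  derivatives by the second connection, and the Lie bracket.\<close>

lemma smooth_field_cong:
  assumes "smooth_field A U X" "\<And>p. p \<in> U \<Longrightarrow> Y p = X p"
  shows "smooth_field A U Y"
proof -
  have "smooth_fun A W (\<lambda>p. Y p f)" if W: "W \<subseteq> U" "smooth_fun A W f" for W f
  proof -
    have "smooth_fun A W (\<lambda>p. X p f)" using assms(1) W by (simp add: smooth_field_def)
    then show ?thesis
      by (subst smooth_fun_cong[where f' = "\<lambda>p. X p f"])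
        (use assms(2) W in \<open>auto simp: chart_inverse smooth_fun_open_image\<close>)
  qed
  then show ?thesis using assms by (auto simp: smooth_field_def)
qed

lemma smooth_field_diff:
  assumes X: "smooth_field A U X" and Y: "smooth_field A U Y"
  shows "smooth_field A U (\<lambda>p. X p - Y p)"
proof -
  have "smooth_fun A W (\<lambda>p. (X p - Y p) f)" if W: "W \<subseteq> U" "smooth_fun A W f" for W f
  proof -
    have "smooth_fun A W (\<lambda>p. X p f)" "smooth_fun A W (\<lambda>p. Y p f)"
      using X Y W by (auto simp: smooth_field_def)
    then show ?thesis using smooth_fun_open_image[OF _ W(2)]
      unfolding smooth_fun_def by (auto simp: o_def intro!: smooth_on_diff)
  qed
  then show ?thesis
    using X Y tvec.subspace_diff[OF subspace_tangent_space] by (auto simp: smooth_field_def)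
qed

end

section \<open>Differentials of smooth maps\<close>

lemma smooth_map_compose:
  fixes A :: "('b::{t2_space, second_countable_topology}, 'm::finite) chart set"
    and B :: "('a::{t2_space, second_countable_topology}, 'n::finite) chart set"
  assumes A: "smooth_manifold A" and B: "smooth_manifold B" and F: "smooth_map A B F"
    and f: "smooth_fun B W f"
  shows "smooth_fun A (F -` W) (f \<circ> F)"
proof -
  have cont: "open (F -` S)" if "open S" for S
    using F that unfolding smooth_map_def continuous_on_open_vimage[OF open_UNIV] by fastforce
  have W: "open W" using f by (simp add: smooth_fun_def)
  have "smooth_on (\<phi> ` (F -` W \<inter> U)) (f \<circ> F \<circ> inv_into U \<phi>)" if U: "(U, \<phi>) \<in> A" for U \<phi>
  proof (rule smooth_on_local)
    fix x assume "x \<in> \<phi> ` (F -` W \<inter> U)"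
    then obtain p where p: "x = \<phi> p" "p \<in> U" "F p \<in> W" by auto
    \<comment> \<open>The chart around \<open>F p\<close> changes with the point, hence the local
      argument; through it \<open>f \<circ> F\<close> factors as
      \<open>(f \<circ> inv_into V \<psi>) \<circ> (\<psi> \<circ> F)\<close>.\<close>
    obtain V \<psi> where V: "(V, \<psi>) \<in> B" "F p \<in> V" using ex_chart[OF B] by blast
    let ?S = "\<phi> ` ((F -` (W \<inter> V)) \<inter> U)"
    have S: "open ?S"
      using W chart_open[OF B V(1)] by (intro chart_image_open[OF A U] cont) auto
    have "smooth_on ?S (\<psi> \<circ> F \<circ> inv_into U \<phi>)"
      by (rule smooth_on_subset[of "\<phi> ` (U \<inter> F -` V)"]) (use F U V(1) in \<open>auto simp: smooth_map_def\<close>)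
    moreover have "(\<psi> \<circ> F \<circ> inv_into U \<phi>) ` ?S \<subseteq> \<psi> ` (W \<inter> V)"
      using chart_inverse[OF A U] by auto
    moreover have "smooth_on (\<psi> ` (W \<inter> V)) (f \<circ> inv_into V \<psi>)"
      using f V(1) by (auto simp: smooth_fun_def)
    ultimately have "smooth_on ?S ((f \<circ> inv_into V \<psi>) \<circ> (\<psi> \<circ> F \<circ> inv_into U \<phi>))"
      using smooth_on_compose[OF S chart_image_open[OF B V(1) W]] by blast
    then have "smooth_on ?S (f \<circ> F \<circ> inv_into U \<phi>)"
      by (rule iffD1[OF smooth_on_cong[OF S], rotated])
        (use chart_inverse[OF A U] chart_inverse[OF B V(1)] in auto)
    then show "\<exists>T. open T \<and> x \<in> T \<and> smooth_on T (f \<circ> F \<circ> inv_into U \<phi>)"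
      using S p V by blast
  qed
  then show ?thesis using cont[OF W] by (auto simp: smooth_fun_def)
qed

lemma pushforward_in_tangent_space:
  fixes A :: "('b::{t2_space, second_countable_topology}, 'm::finite) chart set"
    and B :: "('a::{t2_space, second_countable_topology}, 'n::finite) chart set"
  assumes A: "smooth_manifold A" and B: "smooth_manifold B" and F: "smooth_map A B F"
    and v: "v \<in> tangent_space A p"
  shows "pushforward B F p v \<in> tangent_space B (F p)"
proof -
  obtain U \<phi> where U: "(U, \<phi>) \<in> A" "p \<in> U" using ex_chart[OF A] by blast
  obtain V \<psi> where V: "(V, \<psi>) \<in> B" "F p \<in> V" using ex_chart[OF B] by blast
  obtain a where a: "v = chart_vec A (U, \<phi>) a p" using v by (auto simp: tangent_space_eq[OF A U])
  let ?F = "\<psi> \<circ> F \<circ> inv_into U \<phi>"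
  let ?S = "\<phi> ` (F -` V \<inter> U)"
  have "open (F -` V)"
    using F chart_open[OF B V(1)] unfolding smooth_map_def continuous_on_open_vimage[OF open_UNIV] by fastforce
  then have S: "open ?S" "\<phi> p \<in> ?S" using U V chart_image_open[OF A U(1)] by auto
  have "smooth_on ?S ?F" using F U V by (auto simp: smooth_map_def Int_commute)
  from smooth_on_differentiable[OF this S(2)]
  have F': "(?F has_derivative frechet_derivative ?F (at (\<phi> p))) (at (\<phi> p))"
    by (simp add: frechet_derivative_works)
  have F\<phi>: "?F (\<phi> p) = \<psi> (F p)" by (simp add: chart_inverse[OF A U])
  \<comment> \<open>The components of the image are the Jacobian of \<open>F\<close> in the two
    charts, applied to \<open>a\<close>.\<close>
  have "pushforward B F p v f = chart_vec B (V, \<psi>) (frechet_derivative ?F (at (\<phi> p)) a) (F p) f" for f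
  proof (cases "smooth_near B (F p) f")
    case True
    let ?f = "f \<circ> inv_into V \<psi>"
    \<comment> \<open>Otherwise \<open>v\<close> would return its default value \<open>0\<close> on
      \<open>f \<circ> F\<close>.\<close>
    have "smooth_near A p (f \<circ> F)"
      using True smooth_map_compose[OF A B F] unfolding smooth_near_def by (metis vimageI)
    moreover have "(?f has_derivative frechet_derivative ?f (at (\<psi> (F p)))) (at (?F (\<phi> p)))"
      using smooth_near_differentiable[OF B V True] F\<phi> by (simp add: frechet_derivative_works)
    from diff_chain_at[OF F' this]
    have "(f \<circ> F \<circ> inv_into U \<phi> has_derivative
        frechet_derivative ?f (at (\<psi> (F p))) \<circ> frechet_derivative ?F (at (\<phi> p))) (at (\<phi> p))"
      by (rule has_derivative_transform_within_open[OF _ S])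
        (use chart_inverse[OF A U(1)] chart_inverse[OF B V(1)] in auto)
    then have "frechet_derivative (f \<circ> F \<circ> inv_into U \<phi>) (at (\<phi> p))
        = frechet_derivative ?f (at (\<psi> (F p))) \<circ> frechet_derivative ?F (at (\<phi> p))"
      by (rule frechet_derivative_at[symmetric])
    ultimately show ?thesis using True by (simp add: pushforward_def a chart_vec_def)
  qed (simp add: pushforward_def chart_vec_def)
  then have "pushforward B F p v = chart_vec B (V, \<psi>) (frechet_derivative ?F (at (\<phi> p)) a) (F p)"
    by blast
  then show ?thesis by (simp add: chart_vec_in_tangent_space[OF B V])
qed

section \<open>Lorentzian forms\<close>

text \<open>Models one tangent space with its metric. A metric field is constrained on tangent
  vectors only, so the rules below carry membership in \<open>T\<close>.\<close>

locale symmetric_form =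
  fixes T :: "'a tvec set" and G :: "'a tvec \<Rightarrow> 'a tvec \<Rightarrow> real"
  assumes subspace: "tvec.subspace T"
    and sym: "u \<in> T \<Longrightarrow> v \<in> T \<Longrightarrow> G u v = G v u"
    and linear: "u \<in> T \<Longrightarrow> v \<in> T \<Longrightarrow> w \<in> T \<Longrightarrow> G (a \<odot> u + b \<odot> v) w = a * G u w + b * G v w"
begin

lemma form_add: "u \<in> T \<Longrightarrow> v \<in> T \<Longrightarrow> w \<in> T \<Longrightarrow> G (u + v) w = G u w + G v w"
  using linear[of u v w 1 1] by simp

lemma form_scale: "u \<in> T \<Longrightarrow> w \<in> T \<Longrightarrow> G (a \<odot> u) w = a * G u w"
  using linear[of u u w a 0] by simp

lemma form_diff: "u \<in> T \<Longrightarrow> v \<in> T \<Longrightarrow> w \<in> T \<Longrightarrow> G (u - v) w = G u w - G v w"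
  using linear[of u v w 1 "-1"] by simp

lemma form_sum:
  assumes "\<And>i. i \<in> I \<Longrightarrow> u i \<in> T" "w \<in> T"
  shows "G (\<Sum>i\<in>I. a i \<odot> u i) w = (\<Sum>i\<in>I. a i * G (u i) w)"
  using assms(1)
proof (induction I rule: infinite_finite_induct)
  case (insert i I)
  then have "(\<Sum>i\<in>I. a i \<odot> u i) \<in> T"
    by (intro tvec.subspace_sum tvec.subspace_scale subspace) auto
  moreover have "u i \<in> T" "a i \<odot> u i \<in> T"
    using insert tvec.subspace_scale[OF subspace] by auto
  ultimately show ?case
    using insert assms(2) by (simp add: form_add form_scale del: plus_fun_apply)
qed (use form_scale[of 0 w 0] assms(2) tvec.subspace_0[OF subspace] in auto)

text \<open>
  Reversed Cauchy--Schwarz: with \<open>x\<close>, \<open>y\<close> the coordinates of \<open>\<xi>\<close>, \<open>w\<close> and \<open>x\<^sub>1\<^sup>2 = 1 + |x'|\<^sup>2\<close>,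
  orthogonality and nullity give \<open>(x\<^sub>1 y\<^sub>1)\<^sup>2 \<le> |x'|\<^sup>2 |y'|\<^sup>2 = (x\<^sub>1\<^sup>2 - 1) y\<^sub>1\<^sup>2\<close>.
\<close>

lemma lorentzian_null_orthogonal_eq_0:
  assumes frame: "orthonormal_frame T G 1 n e" and n: "1 \<le> n"
    and \<xi>: "\<xi> \<in> T" "G \<xi> \<xi> = -1" and w: "w \<in> T" "G w \<xi> = 0" "G w w = 0"
  shows "w = 0"
proof -
  have e: "e i \<in> T" if "i \<in> {1..n}" for i
    using frame that unfolding orthonormal_frame_def by blast
  obtain x where x: "\<xi> = (\<Sum>i=1..n. x i \<odot> e i)"
    using frame \<xi>(1) unfolding orthonormal_frame_def by blast
  obtain y where y: "w = (\<Sum>i=1..n. y i \<odot> e i)"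
    using frame w(1) unfolding orthonormal_frame_def by blast
  \<comment> \<open>In frame coordinates the form is diagonal, with the minus sign at index
    \<open>1\<close> only.\<close>
  have form: "G (\<Sum>i=1..n. a i \<odot> e i) (\<Sum>i=1..n. b i \<odot> e i)
      = (\<Sum>i=2..n. a i * b i) - a 1 * b 1" (is "G ?u ?v = _") for a b
  proof -
    have T: "?v \<in> T" using e by (intro tvec.subspace_sum tvec.subspace_scale subspace) auto
    have "G (e i) ?v = (if i \<le> 1 then - b i else b i)" if i: "i \<in> {1..n}" for i
    proof -
      have "G (e i) ?v = (\<Sum>j=1..n. b j * G (e j) (e i))"
        using sym[OF e[OF i] T] form_sum[of "{1..n}" e "e i" b] e i by simp
      also have "\<dots> = (\<Sum>j=1..n. if j = i then (if i \<le> 1 then - b i else b i) else 0)"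
        using frame i unfolding orthonormal_frame_def by (intro sum.cong) auto
      finally show ?thesis using i by simp
    qed
    then have "G ?u ?v = (\<Sum>i=1..n. a i * (if i \<le> 1 then - b i else b i))"
      using form_sum[of "{1..n}" e ?v a] e T by simp
    also have "\<dots> = - (a 1 * b 1) + (\<Sum>i=2..n. a i * (if i \<le> 1 then - b i else b i))"
      using n by (simp add: sum.atLeast_Suc_atMost numeral_2_eq_2)
    also have "(\<Sum>i=2..n. a i * (if i \<le> 1 then - b i else b i)) = (\<Sum>i=2..n. a i * b i)"
      by (intro sum.cong) auto
    finally show ?thesis by simp
  qed
  let ?X = "\<Sum>i=2..n. (x i)\<^sup>2" and ?Y = "\<Sum>i=2..n. (y i)\<^sup>2"
  have X: "?X = (x 1)\<^sup>2 - 1" using \<xi>(2) form[of x x] by (simp add: x power2_eq_square)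
  have Y: "?Y = (y 1)\<^sup>2" using w(3) form[of y y] by (simp add: y power2_eq_square)
  have "(\<Sum>i=2..n. x i * y i) = x 1 * y 1"
    using w(2) form[of y x] by (simp add: x y mult.commute)
  then have "(x 1 * y 1)\<^sup>2 \<le> ?X * ?Y"
    using Cauchy_Schwarz_ineq_sum[of x y "{2..n}"] by simp
  then have "(y 1)\<^sup>2 \<le> 0" unfolding X Y by (simp add: power_mult_distrib algebra_simps)
  then have y1: "y 1 = 0" by simp
  \<comment> \<open>The spatial squares add up to \<open>(y 1)\<^sup>2\<close>, which is now
    \<open>0\<close>, so each of them vanishes.\<close>
  then have "y i = 0" if "i \<in> {2..n}" for i
    using Y that by (simp add: sum_nonneg_eq_0_iff)
  with y1 have "y i = 0" if "i \<in> {1..n}" for i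
    using that by (cases "i = 1") auto
  then show ?thesis by (simp add: y)
qed

end

section \<open>Induced connections and their curvature\<close>

lemma lorentzian_metric_symmetric_form:
  assumes "smooth_manifold B" "lorentzian_metric B g"
  shows "symmetric_form (tangent_space B p) (g p)"
  using assms(2) subspace_tangent_space[OF assms(1)]
  unfolding lorentzian_metric_def symmetric_form_def by fast

text \<open>This is the shape of \<open>connection_along\<close> for the quarter symmetric
  connection, evaluated at a test function: \<open>y\<close> are the components of the field,
  \<open>\<eta> k\<close> the values of the 1-form on the coordinate fields, \<open>z\<close> the
  value of \<xi>. A single \<open>\<eta> k\<close> may be nonzero, but the double sum of the \<eta>
  terms factors, and one factor is the sum assumed to vanish.\<close>

lemma sum_vanishing_term:
  fixes y \<eta> :: "'k \<Rightarrow> real"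
  assumes "(\<Sum>k\<in>K. y k * \<eta> k) = 0"
  shows "(\<Sum>k\<in>K. c k + (\<Sum>i\<in>I. x i * y k * (d i k + \<eta> k * \<phi> i - s i k * z)))
    = (\<Sum>k\<in>K. c k + (\<Sum>i\<in>I. x i * y k * d i k)) - (\<Sum>k\<in>K. \<Sum>i\<in>I. x i * y k * s i k) * z"
proof -
  have "(\<Sum>k\<in>K. \<Sum>i\<in>I. x i * y k * (\<eta> k * \<phi> i)) = (\<Sum>k\<in>K. y k * \<eta> k) * (\<Sum>i\<in>I. x i * \<phi> i)"
    unfolding sum_product by (simp add: mult_ac)
  then have "(\<Sum>k\<in>K. \<Sum>i\<in>I. x i * y k * (\<eta> k * \<phi> i)) = 0"
    using assms by simp
  then show ?thesis
    by (simp add: algebra_simps sum.distrib sum_subtractf sum_distrib_left)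
qed

text \<open>The witness \<open>s\<close> is the coordinate expression of g(\<phi> X, V). Existence
  is enough, since on a C-totally real submanifold every multiple of \<xi> is normal.\<close>

lemma connection_along_quarter_symmetric:
  assumes B: "smooth_manifold B" "lorentzian_metric B g" "\<xi> (F p) \<in> tangent_space B (F p)"
    and V: "V p \<in> tangent_space B (F p)" "eta g \<xi> (F p) (V p) = 0"
  shows "\<exists>s. connection_along B F (quarter_symmetric_connection g D \<xi> \<alpha>) X V p
    = connection_along B F D X V p - s \<odot> \<xi> (F p)"
proof -
  \<comment> \<open>The same choice as in \<open>connection_along\<close>, so that unfolding
    produces this very chart.\<close>
  define c where "c = (SOME c. c \<in> B \<and> F p \<in> fst c)"
  have "\<exists>c. c \<in> B \<and> F p \<in> fst c" using ex_chart[OF B(1), of "F p"] by force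
  then have "c \<in> B \<and> F p \<in> fst c" unfolding c_def by (rule someI_ex)
  then obtain S \<psi> where c: "c = (S, \<psi>)" "(S, \<psi>) \<in> B" "F p \<in> S" by (cases c) auto
  interpret symmetric_form "tangent_space B (F p)" "g (F p)"
    by (rule lorentzian_metric_symmetric_form[OF B(1,2)])
  let ?E = "coord_field B c"
  define x where "x i = pushforward B F p (X p) (\<lambda>x. \<psi> x $ i)" for i
  define y where "y k = V p (\<lambda>x. \<psi> x $ k)" for k
  define \<eta> where "\<eta> k = eta g \<xi> (F p) (?E k (F p))" for k
  define \<phi> where "\<phi> i = structure_tensor D \<xi> \<alpha> (?E i) (F p)" for i
  define s where "s i k = g (F p) (\<phi> i) (?E k (F p))" for i k
  have "V p = (\<Sum>k\<in>UNIV. y k \<odot> ?E k (F p))"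
    using tangent_vector_expand[OF B(1) c(2,3) V(1)] by (simp add: y_def c)
  with V(2) have "(\<Sum>k\<in>UNIV. y k * \<eta> k) = 0"
    using coord_field_in_tangent_space[OF B(1) c(2,3)] B(3)
    by (simp add: eta_def \<eta>_def form_sum c)
  note vanish = sum_vanishing_term[OF this]
  have "connection_along B F (quarter_symmetric_connection g D \<xi> \<alpha>) X V p
      = connection_along B F D X V p - (\<Sum>k\<in>UNIV. \<Sum>i\<in>UNIV. x i * y k * s i k) \<odot> \<xi> (F p)"
    unfolding connection_along_def Let_def c_def[symmetric] quarter_symmetric_connection_def
    by (simp add: fun_eq_iff sum_fun_apply tscale_apply c
          flip: x_def y_def \<eta>_def[unfolded c] \<phi>_def[unfolded c] s_def[unfolded c])
      (intro allI vanish)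
  then show ?thesis by blast
qed

lemma induced_connections_eq:
  fixes A :: "('b::{t2_space, second_countable_topology}, 'm::finite) chart set"
    and B :: "('a::{t2_space, second_countable_topology}, 'n::finite) chart set"
  assumes LCS: "LCS_manifold B g D \<xi> \<alpha>"
    and A: "smooth_manifold A" and imm: "immersion A B F"
    and real: "C_totally_real A B F g \<xi>"
    and D': "gauss_formula A B F g D D' h"
    and Dq: "gauss_formula A B F g (quarter_symmetric_connection g D \<xi> \<alpha>) Dq hq"
    and XY: "smooth_field A U X" "smooth_field A U Y" and p: "p \<in> U"
  shows "Dq X Y p = D' X Y p"
proof -
  have B: "smooth_manifold B" "lorentzian_metric B g"
    and \<xi>: "\<xi> (F p) \<in> tangent_space B (F p)" "g (F p) (\<xi> (F p)) (\<xi> (F p)) = -1"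
    using LCS by (auto simp: LCS_manifold_def smooth_field_def)
  have F: "smooth_map A B F" "inj_on (pushforward B F p) (tangent_space A p)"
    using imm by (auto simp: immersion_def)
  note dF = pushforward_in_tangent_space[OF A B(1) F(1)]
  interpret symmetric_form "tangent_space B (F p)" "g (F p)"
    by (rule lorentzian_metric_symmetric_form[OF B])
  let ?dF = "pushforward B F p" and ?N = "normal_space A B F g p"
  have \<xi>N: "\<xi> (F p) \<in> ?N" using real by (simp add: C_totally_real_def)
  have N: "\<nu> \<in> tangent_space B (F p)" "v \<in> tangent_space A p \<Longrightarrow> g (F p) \<nu> (?dF v) = 0" if "\<nu> \<in> ?N" for \<nu> v
    using that by (auto simp: normal_space_def)
  have Y: "Y p \<in> tangent_space A p" using XY p by (auto simp: smooth_field_def)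
  let ?V = "\<lambda>q. pushforward B F q (Y q)"
  have "eta g \<xi> (F p) (?V p) = 0"
    unfolding eta_def using N[OF \<xi>N] dF[OF Y] Y sym by auto
  then obtain s where s: "connection_along B F (quarter_symmetric_connection g D \<xi> \<alpha>) X ?V p
      = connection_along B F D X ?V p - s \<odot> \<xi> (F p)"
    using connection_along_quarter_symmetric[where F = F and \<xi> = \<xi> and p = p and V = ?V, OF B \<xi>(1)] dF[OF Y] by blast
  let ?u = "D' X Y p" and ?v = "Dq X Y p"
  have u: "?u \<in> tangent_space A p" "h X Y p \<in> ?N"
    "connection_along B F D X ?V p = ?dF ?u + h X Y p"
    using D' XY p unfolding gauss_formula_def by blast+
  have v: "?v \<in> tangent_space A p" "hq X Y p \<in> ?N"
    "connection_along B F (quarter_symmetric_connection g D \<xi> \<alpha>) X ?V p = ?dF ?v + hq X Y p"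
    using Dq XY p unfolding gauss_formula_def by blast+
  \<comment> \<open>As a combination of normal vectors \<open>w\<close> is orthogonal to all images
    of tangent vectors, and it is itself a difference of two such images; hence
    \<open>g (F p) w w = 0\<close>.\<close>
  define w where "w = ?dF ?v - ?dF ?u"
  have w: "w = (h X Y p - hq X Y p) - s \<odot> \<xi> (F p)"
    using s u(3) v(3) by (simp add: w_def algebra_simps)
  have wT: "w \<in> tangent_space B (F p)"
    unfolding w_def by (intro tvec.subspace_diff[OF subspace] dF u v)
  have "g (F p) w (?dF z) = 0" if z: "z \<in> tangent_space A p" for z
    unfolding w using N[OF u(2)] N[OF v(2)] N[OF \<xi>N] z dF[OF z]
    by (simp add: form_diff form_scale tvec.subspace_diff[OF subspace] tvec.subspace_scale[OF subspace])
  then have "g (F p) w w = 0"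
    using form_diff[OF dF[OF v(1)] dF[OF u(1)] wT] sym[OF wT] u(1) v(1) dF by (simp flip: w_def)
  moreover have "g (F p) w (\<xi> (F p)) = 0"
    unfolding w_def using N[OF \<xi>N] u(1) v(1) dF \<xi>(1) by (simp add: form_diff sym)
  moreover obtain e where "orthonormal_frame (tangent_space B (F p)) (g (F p)) 1 CARD('n) e"
    using B(2) unfolding lorentzian_metric_def by blast
  ultimately have "w = 0"
    using lorentzian_null_orthogonal_eq_0[OF _ _ \<xi> wT] by (simp add: Suc_leI)
  then show ?thesis using F(2) u(1) v(1) by (simp add: w_def inj_on_def)
qed

text \<open>\<open>D'\<close> is known only on smooth fields over open sets. In a second derivative
  the inner \<open>D' Q Z\<close> is first seen to be smooth by comparison with
  \<open>D Q Z\<close>; then the outer \<open>D'\<close> becomes \<open>D\<close>, and locality of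
  \<open>D\<close> replaces the inner one.\<close>

lemma curvature_eq_if_connections_eq:
  fixes A :: "('b::{t2_space, second_countable_topology}, 'm::finite) chart set"
  assumes A: "smooth_manifold A" and LC: "levi_civita A g D"
    and eq: "\<And>U X Y p. smooth_field A U X \<Longrightarrow> smooth_field A U Y \<Longrightarrow> p \<in> U \<Longrightarrow> D' X Y p = D X Y p"
    and X: "smooth_field A U X" and Y: "smooth_field A U Y" and Z: "smooth_field A U Z" and p: "p \<in> U"
  shows "curvature A D' X Y Z p = curvature A D X Y Z p"
proof -
  have D: "affine_connection A D" using LC by (simp add: levi_civita_def)
  have smooth: "smooth_field A U (D P Q)" if "smooth_field A U P" "smooth_field A U Q" for P Q
    using conjunct1[OF D[unfolded affine_connection_def]] that by blast
  have second: "D' P (D' Q Z) p = D P (D Q Z) p" if P: "smooth_field A U P" and Q: "smooth_field A U Q" for P Q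
  proof -
    have "smooth_field A U (D' Q Z)"
      using smooth_field_cong[OF A smooth[OF Q Z]] eq[OF Q Z] by blast
    then have "D' P (D' Q Z) p = D P (D' Q Z) p" using eq P p by blast
    also have "\<dots> = D P (D Q Z) p"
      by (rule D[unfolded affine_connection_def, THEN conjunct2, THEN conjunct2, THEN conjunct2, THEN conjunct2,
            rule_format, OF P smooth[OF Q Z]]) (use eq[OF Q Z] p in simp_all)
    finally show ?thesis .
  qed
  \<comment> \<open>The bracket must be smooth to be an argument of the connections; vanishing
    torsion writes it as \<open>D X Y - D Y X\<close>.\<close>
  have "smooth_field A U (lie_bracket A X Y)"
    using smooth_field_cong[OF A smooth_field_diff[OF A smooth[OF X Y] smooth[OF Y X]]] LC X Y
    unfolding levi_civita_def by metis
  then show ?thesis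
    using second[OF X Y] second[OF Y X] eq Z p by (simp add: curvature_def)
qed

theorem theorem3p3:
  fixes B :: "('a::{t2_space, second_countable_topology}, 'n::finite) chart set"
    and A :: "('b::{t2_space, second_countable_topology}, 'm::finite) chart set"
    and g :: "'a metric_field" and D :: "'a connection" and \<xi> :: "'a vfield" and \<alpha> :: "'a \<Rightarrow> real"
    and F :: "'b \<Rightarrow> 'a"
    and DM Dq :: "'b connection"
    and h hq :: "'b vfield \<Rightarrow> 'b vfield \<Rightarrow> 'b \<Rightarrow> 'a tvec"
    and p :: 'b and e :: "nat \<Rightarrow> 'b tvec"
  assumes "LCS_manifold B g D \<xi> \<alpha>"
    and "smooth_manifold A" and "immersion A B F" and "CARD('m) < CARD('n)"
    and "C_totally_real A B F g \<xi>"
    and "levi_civita A (induced_metric B F g) DM"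
    and "gauss_formula A B F g D DM h"
    and "gauss_formula A B F g (quarter_symmetric_connection g D \<xi> \<alpha>) Dq hq"
    and "orthonormal_frame (tangent_space A p) (induced_metric B F g p) 0 CARD('m) e"
  shows "scalar_curvature A (induced_metric B F g) DM p e
       = scalar_curvature A (induced_metric B F g) Dq p e"
proof -
  have "curvature_tensor A (induced_metric B F g) DM p u v w z
      = curvature_tensor A (induced_metric B F g) Dq p u v w z"
    if uvw: "u \<in> tangent_space A p" "v \<in> tangent_space A p" "w \<in> tangent_space A p" for u v w z
  proof -
    let ?X = "field_extension A p"
    obtain U V W where p: "p \<in> U" "p \<in> V" "p \<in> W"
      and UVW: "smooth_field A U (?X u)" "smooth_field A V (?X v)" "smooth_field A W (?X w)"
      using field_extension[OF assms(2)] uvw by metis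
    \<comment> \<open>Each extension comes with its own domain; on the intersection both curvatures
      are compared for the same chosen fields.\<close>
    let ?S = "U \<inter> V \<inter> W"
    have "open ?S" using UVW by (auto simp: smooth_field_def)
    then have S: "smooth_field A ?S (?X u)" "smooth_field A ?S (?X v)" "smooth_field A ?S (?X w)"
      using UVW by (auto elim!: smooth_field_subset[OF assms(2)])
    have "curvature A Dq (?X u) (?X v) (?X w) p = curvature A DM (?X u) (?X v) (?X w) p"
      by (rule curvature_eq_if_connections_eq[OF assms(2,6)
            induced_connections_eq[OF assms(1,2,3,5,7,8)] S]) (use p in auto)
    then show ?thesis by (simp add: curvature_tensor_def)
  qed
  moreover have "e i \<in> tangent_space A p" if "1 \<le> i" "i \<le> CARD('m)" for i
    using assms(9) that unfolding orthonormal_frame_def by auto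
  ultimately show ?thesis
    unfolding scalar_curvature_def by (intro sum.cong) auto
qed

end
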